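(* Let $1<p\le q\le\infty$ and $\alpha,\beta\in\mathbb{R}$. Suppose one of the following holds: (i) $\alpha>0$ and $\beta\ge\frac{\alpha d}{2q}+\frac d2\big(\frac1p-\frac1q\big)$; (ii) $\alpha=0$ and $\beta=\frac d2\big(\frac1p-\frac1q\big)$; (iii) $\alpha<0$ and $\beta\le\frac{\alpha d}{2q}+\frac d2\big(\frac1p-\frac1q\big)$. Then $\mathcal{M}_{\alpha,\beta}$ is bounded from $L^p(\mathbb{R}^d)$ to $L^q(\mathbb{R}^d)$.
   Context: With $\Gamma_\alpha(x)=\{(y,t)\in\mathbb{R}^d\times\mathbb{R}_+:t^\alpha\le1,\ |y-x|\le t^{1-\alpha}\}$, $$\mathcal{M}_{\alpha,\beta}w(x)=\sup_{(y,r)\in\Gamma_\alpha(x)}\frac{1}{|B(y,r)|^{1-2\beta/d}}\int_{B(y,r)}|w|.$$ *)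

theory Defs
  imports "HOL-Analysis.Analysis"
begin

definition Gamma_region :: "real \<Rightarrow> 'a::euclidean_space \<Rightarrow> ('a \<times> real) set" where
  "Gamma_region \<alpha> x = {(y, t). t > 0 \<and> t powr \<alpha> \<le> 1 \<and> dist y x \<le> t powr (1 - \<alpha>)}"

definition max_op :: "real \<Rightarrow> real \<Rightarrow> ('a::euclidean_space \<Rightarrow> real) \<Rightarrow> 'a \<Rightarrow> ennreal" where
  "max_op \<alpha> \<beta> w x =
     (SUP yr \<in> Gamma_region \<alpha> x.
        ennreal (1 / measure lebesgue (ball (fst yr) (snd yr)) powr (1 - 2 * \<beta> / real DIM('a)))
        * (\<integral>\<^sup>+ z \<in> ball (fst yr) (snd yr). ennreal \<bar>w z\<bar> \<partial>lebesgue))"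

text \<open>Real powers on [0,\<infinity>] for positive exponents.\<close>
definition enn_powr :: "ennreal \<Rightarrow> real \<Rightarrow> ennreal" where
  "enn_powr a s = (if a = \<infinity> then \<infinity> else ennreal (enn2real a powr s))"

definition Lp_norm :: "ennreal \<Rightarrow> ('a::euclidean_space \<Rightarrow> ennreal) \<Rightarrow> ennreal" where
  "Lp_norm p f =
     (if p = \<infinity> then Inf {C. AE x in lebesgue. f x \<le> C}
      else enn_powr (\<integral>\<^sup>+ x. enn_powr (f x) (enn2real p) \<partial>lebesgue) (1 / enn2real p))"

text \<open>Reciprocal of an exponent in (0,\<infinity>], with 1/\<infinity> = 0.\<close>
definition recip :: "ennreal \<Rightarrow> real" where
  "recip p = enn2real (inverse p)"

definition bounded_Lp_Lq ::
  "ennreal \<Rightarrow> ennreal \<Rightarrow> (('a::euclidean_space \<Rightarrow> real) \<Rightarrow> 'a \<Rightarrow> ennreal) \<Rightarrow> bool" where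
  "bounded_Lp_Lq p q T \<longleftrightarrow> (\<exists>C::real. \<forall>w.
      w \<in> borel_measurable lebesgue \<and> Lp_norm p (\<lambda>x. ennreal \<bar>w x\<bar>) < \<infinity> \<longrightarrow>
        T w \<in> borel_measurable lebesgue \<and>
        Lp_norm q (T w) \<le> ennreal C * Lp_norm p (\<lambda>x. ennreal \<bar>w x\<bar>))"

end

theory Submission
  imports Defs
begin

text \<open>
  Write \<open>A\<close> for the average of \<open>\<bar>w\<bar>\<close> over \<open>ball y r\<close> and \<open>n\<close> for the dimension. On the region the
  excess of \<open>\<beta>\<close> over its critical value only helps, and Hoelder reduces \<open>p < q\<close> to \<open>p = q\<close>, so the
  point is to control \<open>r powr (\<alpha> * n) * A powr p\<close> by an integrable function of the vertex \<open>x\<close>.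
  The measures \<open>r powr (\<alpha> * n) dx\<close> satisfy a Carleson condition: the balls inside \<open>ball z s\<close> of
  radius about \<open>t\<close> are seen from points \<open>x\<close> within \<open>O(t powr (1 - \<alpha>))\<close> of \<open>z\<close> (or within \<open>2 * s\<close>), which
  contributes \<open>O(t ^ n)\<close>, and summing over \<open>t = s / 2 ^ j\<close> gives \<open>O(s ^ n)\<close>. The Vitali covering lemma
  turns this into a weak-type estimate at every height of \<open>A\<close>. Truncating \<open>w\<close> at height
  \<open>2 powr (k - 1)\<close> and summing the weak-type bounds over the dyadic heights \<open>2 powr k\<close> gives the
  strong-type bound, as in Marcinkiewicz interpolation.
\<close>

section \<open>Balls, countable sums and dyadic scales\<close>

lemma emeasure_lebesgue_cball:
  fixes y :: "'a::euclidean_space"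
  assumes "r \<ge> 0"
  shows "emeasure lebesgue (cball y r) = ennreal (unit_ball_vol (real DIM('a)) * r ^ DIM('a))"
  using emeasure_cball[OF assms, of y] by simp

lemma measure_lebesgue_ball_pos:
  fixes y :: "'a::euclidean_space"
  assumes "r > 0"
  shows "measure lebesgue (ball y r) > 0"
  using assms by (simp add: content_ball)

text \<open>Enumerating an infinite \<open>I\<close> turns the integral into a series over the
  naturals. Sums over a countable family of balls and over integer heights are both written in this
  form.\<close>

lemma borel_measurable_nn_integral_count_space:
  fixes f :: "'i \<Rightarrow> 'a \<Rightarrow> ennreal"
  assumes "countable I" and [measurable]: "\<And>i. i \<in> I \<Longrightarrow> f i \<in> borel_measurable M"
  shows "(\<lambda>x. \<integral>\<^sup>+i. f i x \<partial>count_space I) \<in> borel_measurable M"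
proof (cases "finite I")
  case True
  then show ?thesis by (simp add: nn_integral_count_space_finite)
next
  case False
  then have bij: "bij_betw (from_nat_into I) UNIV I" and [simp]: "I \<noteq> {}"
    using bij_betw_from_nat_into[OF assms(1)] by auto
  have "(\<integral>\<^sup>+i. f i x \<partial>count_space I) = (\<Sum>n. f (from_nat_into I n) x)" for x
    by (simp add: nn_integral_bij_count_space[symmetric, OF bij] nn_integral_count_space_nat)
  then show ?thesis
    using from_nat_into[of I] by simp
qed

text \<open>Take the least \<open>j\<close> with \<open>s / 2 ^ j < r\<close>. Since
  \<open>r \<le> s\<close> it is not 0, and its predecessor is the required index.\<close>

lemma halving_interval:
  fixes r s :: real
  assumes "0 < r" "r \<le> s"
  obtains j :: nat where "s / 2 ^ Suc j < r" "r \<le> s / 2 ^ j"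
proof -
  have "\<exists>j. s / 2 ^ j < r"
  proof -
    obtain j where "s / r < 2 ^ j"
      using real_arch_pow[of 2 "s / r"] by auto
    then show ?thesis using assms by (intro exI[of _ j]) (auto simp: field_simps)
  qed
  define j where "j = (LEAST j. s / 2 ^ j < r)"
  have j: "s / 2 ^ j < r" unfolding j_def by (rule LeastI_ex) fact
  with assms obtain i where i: "j = Suc i" by (cases j) auto
  have "\<not> s / 2 ^ i < r" using not_less_Least[of i "\<lambda>j. s / 2 ^ j < r"] i j_def by auto
  with j i that show thesis by force
qed

text \<open>The power is monotone, increasing or decreasing with the sign of \<open>a\<close>. In
  the decreasing case \<open>r\<close> is compared with \<open>t / 2\<close>, which costs
  \<open>2 powr (- a)\<close>; the absolute value covers both signs.\<close>

lemma powr_doubling: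
  fixes r t a :: real
  assumes "0 < r" "t / 2 < r" "r \<le> t"
  shows "r powr a \<le> 2 powr \<bar>a\<bar> * t powr a"
proof (cases "a \<ge> 0")
  case True
  have "r powr a \<le> t powr a" using assms True by (intro powr_mono2) auto
  also have "\<dots> \<le> 2 powr \<bar>a\<bar> * t powr a"
    using ge_one_powr_ge_zero[of 2 "\<bar>a\<bar>"] by (simp add: mult_le_cancel_right1)
  finally show ?thesis .
next
  case False
  have "r powr a \<le> (t / 2) powr a" using assms False by (intro powr_mono2') auto
  also have "\<dots> = 2 powr \<bar>a\<bar> * t powr a"
    using assms False by (simp add: powr_divide powr_minus field_simps)
  finally show ?thesis .
qed

lemma nn_integral_cmult_indicator_cball:
  fixes z :: "'a::euclidean_space"
  assumes "c \<ge> 0" "r \<ge> 0"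
  shows "(\<integral>\<^sup>+x. ennreal c * indicator (cball z r) x \<partial>lebesgue)
    = ennreal (c * (unit_ball_vol (real DIM('a)) * r ^ DIM('a)))"
  using assms by (simp add: nn_integral_cmult_indicator emeasure_lebesgue_cball ennreal_mult
      del: emeasure_completion)

section \<open>Carleson condition\<close>

text \<open>Vertices \<open>x\<close> within \<open>2 * s\<close> of \<open>z\<close> are paid for
  by one indicator, because \<open>r powr \<alpha> \<le> 1\<close> on the region. For farther ones
  the aperture must exceed \<open>s\<close>, so \<open>x\<close> is within
  \<open>2 * r powr (1 - \<alpha>)\<close> of \<open>z\<close>; the dyadic scale \<open>t\<close> of
  \<open>r\<close> then contributes height \<open>t powr (\<alpha> * n)\<close> times volume
  \<open>t powr ((1 - \<alpha>) * n)\<close>, that is \<open>t ^ n\<close> up to constants, and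
  these form a convergent series. An explicit \<open>K\<close> avoids the measurability of a
  supremum over balls.\<close>

lemma tent_majorant:
  fixes \<alpha> :: real
  shows "\<exists>C>0. \<forall>(z::'a::euclidean_space) s. s > 0 \<longrightarrow> (\<exists>K \<in> borel_measurable lebesgue.
       (\<integral>\<^sup>+x. K x \<partial>lebesgue) \<le> ennreal (C * s ^ DIM('a)) \<and>
       (\<forall>x y r. (y, r) \<in> Gamma_region \<alpha> x \<and> ball y r \<subseteq> ball z s
          \<longrightarrow> ennreal (r powr (\<alpha> * real DIM('a))) \<le> K x))"
proof -
  let ?n = "DIM('a)"
  define \<omega> where "\<omega> = unit_ball_vol (real ?n)"
  have \<omega>: "\<omega> > 0" unfolding \<omega>_def by simp
  \<comment> \<open>\<open>a\<close> is the doubling loss for the weight and \<open>b\<close> the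
    one for the aperture, with an extra 2 from the far-vertex estimate \<open>zx\<close>. In
    \<open>C\<close> the first summand is the near ball, the second the series over scales, whose
    geometric sum is 2.\<close>
  define a where "a = 2 powr \<bar>\<alpha> * real ?n\<bar>"
  define b where "b = 2 * 2 powr \<bar>1 - \<alpha>\<bar>"
  have ab: "a > 0" "b > 0" unfolding a_def b_def by auto
  define C where "C = \<omega> * 2 ^ ?n + a * \<omega> * b ^ ?n * 2"
  show ?thesis
  proof (intro exI[of _ C] conjI allI impI)
    show "C > 0" unfolding C_def using ab \<omega> by (intro add_pos_pos mult_pos_pos) auto
    fix z :: 'a and s :: real assume s: "s > 0"
    define t where "t j = s / 2 ^ j" for j :: nat
    have t: "t j > 0" for j unfolding t_def using s by auto
    define f where "f j x = ennreal (a * t j powr (\<alpha> * real ?n)) * indicator (cball z (b * t j powr (1 - \<alpha>))) x"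
      for j x
    define K where "K x = indicator (cball z (2 * s)) x + (\<Sum>j. f j x)" for x
    have mf[measurable]: "f j \<in> borel_measurable lebesgue" for j
      unfolding f_def
      by (intro borel_measurable_times_ennreal borel_measurable_const borel_measurable_indicator) simp
    have mK: "K \<in> borel_measurable lebesgue" unfolding K_def
      by (intro borel_measurable_add borel_measurable_suminf_order borel_measurable_indicator mf) simp
    have If: "(\<integral>\<^sup>+x. f j x \<partial>lebesgue) \<le> ennreal (a * \<omega> * b ^ ?n * s ^ ?n * (1/2) ^ j)" for j
    proof -
      have "(\<integral>\<^sup>+x. f j x \<partial>lebesgue)
          = ennreal (a * t j powr (\<alpha> * real ?n) * (\<omega> * (b * t j powr (1 - \<alpha>)) ^ ?n))"
        unfolding f_def \<omega>_def using ab t by (intro nn_integral_cmult_indicator_cball) auto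
      also have "a * t j powr (\<alpha> * real ?n) * (\<omega> * (b * t j powr (1 - \<alpha>)) ^ ?n)
          = a * \<omega> * b ^ ?n * (t j powr (\<alpha> * real ?n) * t j powr ((1 - \<alpha>) * real ?n))"
      proof -
        have "(t j powr (1 - \<alpha>)) ^ ?n = t j powr ((1 - \<alpha>) * real ?n)"
          using t[of j] powr_realpow[of "t j powr (1 - \<alpha>)" ?n] by (simp add: powr_powr)
        then show ?thesis by (simp add: power_mult_distrib)
      qed
      also have "t j powr (\<alpha> * real ?n) * t j powr ((1 - \<alpha>) * real ?n) = t j ^ ?n"
        using t[of j] by (simp add: algebra_simps flip: powr_add powr_realpow)
      also have "t j ^ ?n = s ^ ?n * ((1/2) ^ j) ^ ?n"
        unfolding t_def by (simp add: power_divide)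
      also have "ennreal (a * \<omega> * b ^ ?n * (s ^ ?n * ((1/2) ^ j) ^ ?n))
          \<le> ennreal (a * \<omega> * b ^ ?n * s ^ ?n * (1/2) ^ j)"
      proof -
        \<comment> \<open>The dimension is at least 1, so the ratio \<open>(1/2) ^ n\<close> may be
          replaced by \<open>1/2\<close>, giving one series for all dimensions.\<close>
        have "((1/2::real) ^ j) ^ ?n \<le> ((1/2) ^ j) ^ 1"
          by (intro power_decreasing) (auto simp: Suc_leI power_le_one)
        then show ?thesis using ab \<omega> s
          by (intro ennreal_leI) (simp add: mult.assoc)
      qed
      finally show ?thesis .
    qed
    have sums: "(\<lambda>j. a * \<omega> * b ^ ?n * s ^ ?n * (1/2) ^ j) sums (a * \<omega> * b ^ ?n * s ^ ?n * 2)"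
      using sums_mult[OF geometric_sums[of "1/2::real"]] by simp
    have "(\<integral>\<^sup>+x. K x \<partial>lebesgue)
        = (\<integral>\<^sup>+x. ennreal 1 * indicator (cball z (2 * s)) x \<partial>lebesgue) + (\<Sum>j. \<integral>\<^sup>+x. f j x \<partial>lebesgue)"
      unfolding K_def
      by (subst nn_integral_add)
         (auto intro!: borel_measurable_suminf_order borel_measurable_indicator mf
            simp: nn_integral_suminf[OF mf] simp del: emeasure_completion)
    also have "\<dots> \<le> ennreal (1 * (\<omega> * (2 * s) ^ ?n))
        + (\<Sum>j. ennreal (a * \<omega> * b ^ ?n * s ^ ?n * (1/2) ^ j))"
      unfolding \<omega>_def
      by (intro add_mono suminf_le If[unfolded \<omega>_def])
         (use s nn_integral_cmult_indicator_cball[of 1 "2 * s" z] in auto)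
    also have "(\<Sum>j. ennreal (a * \<omega> * b ^ ?n * s ^ ?n * (1/2) ^ j)) = ennreal (a * \<omega> * b ^ ?n * s ^ ?n * 2)"
      using ab \<omega> s by (intro suminf_ennreal_eq sums) auto
    also have "ennreal (1 * (\<omega> * (2 * s) ^ ?n)) + \<dots> = ennreal (C * s ^ ?n)"
      unfolding C_def using ab \<omega> s
      by (subst ennreal_plus[symmetric]) (auto simp: algebra_simps power_mult_distrib)
    finally have IK: "(\<integral>\<^sup>+x. K x \<partial>lebesgue) \<le> ennreal (C * s ^ ?n)" .
    have "ennreal (r powr (\<alpha> * real ?n)) \<le> K x"
      if xyr: "(y, r) \<in> Gamma_region \<alpha> x" and sub: "ball y r \<subseteq> ball z s" for x y r
    proof -
      from xyr have r: "r > 0" "r powr \<alpha> \<le> 1" "dist y x \<le> r powr (1 - \<alpha>)"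
        unfolding Gamma_region_def by auto
      from sub r have yz: "dist y z + r \<le> s" by (simp add: ball_subset_ball_iff)
      then have rs: "r \<le> s" using zero_le_dist[of y z] by linarith
      show ?thesis
      proof (cases "dist z x \<le> 2 * s")
        case True
        have "r powr (\<alpha> * real ?n) = (r powr \<alpha>) powr real ?n" by (simp add: powr_powr)
        also have "\<dots> \<le> 1" using r by (intro powr_le1) auto
        finally have "ennreal (r powr (\<alpha> * real ?n)) \<le> 1" by (simp add: ennreal_le_1)
        also have "1 \<le> K x" using True unfolding K_def by auto
        finally show ?thesis .
      next
        case False
        have "dist z x \<le> s + r powr (1 - \<alpha>)"
          using dist_triangle[of z x y] yz r by (simp add: dist_commute)
        \<comment> \<open>Here \<open>s\<close> is less than half of \<open>dist z x\<close> and is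
          absorbed into the left side.\<close>
        with False have zx: "dist z x \<le> 2 * r powr (1 - \<alpha>)" by linarith
        obtain j where j: "t (Suc j) < r" "r \<le> t j"
          using halving_interval[OF r(1) rs] unfolding t_def by metis
        then have j': "t j / 2 < r" unfolding t_def by simp
        have "r powr (1 - \<alpha>) \<le> 2 powr \<bar>1 - \<alpha>\<bar> * t j powr (1 - \<alpha>)"
          using r j j' by (intro powr_doubling) auto
        with zx have "x \<in> cball z (b * t j powr (1 - \<alpha>))" unfolding b_def by simp
        moreover have "r powr (\<alpha> * real ?n) \<le> a * t j powr (\<alpha> * real ?n)"
          unfolding a_def using r j j' by (intro powr_doubling) auto
        ultimately have "ennreal (r powr (\<alpha> * real ?n)) \<le> f j x"
          unfolding f_def by (simp add: ennreal_leI)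
        also have "\<dots> \<le> (\<Sum>j. f j x)"
          using sum_le_suminf[of "\<lambda>j. f j x" "{j}"] by simp
        also have "\<dots> \<le> K x" unfolding K_def by simp
        finally show ?thesis .
      qed
    qed
    with mK IK show "\<exists>K \<in> borel_measurable lebesgue.
       (\<integral>\<^sup>+x. K x \<partial>lebesgue) \<le> ennreal (C * s ^ ?n) \<and>
       (\<forall>x y r. (y, r) \<in> Gamma_region \<alpha> x \<and> ball y r \<subseteq> ball z s
          \<longrightarrow> ennreal (r powr (\<alpha> * real ?n)) \<le> K x)"
      by blast
  qed
qed

section \<open>Weak-type estimate by Vitali covering\<close>

text \<open>A point lies in at most one of the sets, so at most one term survives.\<close>

lemma nn_integral_count_space_disjoint_le:
  assumes "disjoint_family_on B J"
  shows "(\<integral>\<^sup>+j. c * indicator (B j) x \<partial>count_space J) \<le> (c :: ennreal)"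
proof (cases "\<exists>j\<in>J. x \<in> B j")
  case True
  then obtain i where i: "i \<in> J" "x \<in> B i" by blast
  have "(\<integral>\<^sup>+j. c * indicator (B j) x \<partial>count_space J) = (\<integral>\<^sup>+j. c * indicator {i} j \<partial>count_space J)"
    using i assms by (intro nn_integral_cong) (auto simp: disjoint_family_on_def indicator_def)
  also have "\<dots> = c" using i by (simp add: nn_integral_cmult_indicator)
  finally show ?thesis by simp
next
  case False
  then have "(\<integral>\<^sup>+j. c * indicator (B j) x \<partial>count_space J) = (\<integral>\<^sup>+j. 0 \<partial>count_space J)"
    by (intro nn_integral_cong) (auto simp: indicator_def)
  then show ?thesis by simp
qed

text \<open>Among the balls with average at least \<open>l\<close>, select disjoint ones whose
  fivefold enlargements contain all the others. \<open>h\<close> is the sum of the tent majorants of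
  the enlargements. Each of these has integral at most a constant times the volume of the selected
  ball, hence at most \<open>C / l\<close> times the integral of \<open>g\<close> over it, and
  disjointness allows summation. A majorant, rather than the measure of a level set, is what can
  later be summed over heights.\<close>

lemma level_set_majorant:
  fixes \<alpha> :: real
  shows "\<exists>C>0. \<forall>(g::'a::euclidean_space \<Rightarrow> ennreal) l.
       l > 0 \<and> g \<in> borel_measurable lebesgue \<longrightarrow>
       (\<exists>h \<in> borel_measurable lebesgue.
       (\<integral>\<^sup>+x. h x \<partial>lebesgue) \<le> ennreal (C / l) * (\<integral>\<^sup>+x. g x \<partial>lebesgue) \<and>
       (\<forall>x y r. (y, r) \<in> Gamma_region \<alpha> x \<and>
          ennreal (l * measure lebesgue (ball y r)) \<le> (\<integral>\<^sup>+z\<in>ball y r. g z \<partial>lebesgue)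
          \<longrightarrow> ennreal (r powr (\<alpha> * real DIM('a))) \<le> h x))"
proof -
  let ?n = "DIM('a)"
  define \<omega> where "\<omega> = unit_ball_vol (real ?n)"
  have \<omega>: "\<omega> > 0" unfolding \<omega>_def by simp
  obtain C1 where C1: "C1 > 0"
    and tent: "\<And>(z::'a) s. s > 0 \<Longrightarrow> \<exists>K \<in> borel_measurable lebesgue.
       (\<integral>\<^sup>+x. K x \<partial>lebesgue) \<le> ennreal (C1 * s ^ ?n) \<and>
       (\<forall>x y r. (y, r) \<in> Gamma_region \<alpha> x \<and> ball y r \<subseteq> ball z s
          \<longrightarrow> ennreal (r powr (\<alpha> * real ?n)) \<le> K x)"
    using tent_majorant[where 'a = 'a and \<alpha> = \<alpha>] by blast
  \<comment> \<open>The factor \<open>5 ^ n\<close> is the cost of the enlargement; division by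
    \<open>\<omega>\<close> turns powers of the radius into volumes.\<close>
  define C where "C = C1 * 5 ^ ?n / \<omega>"
  show ?thesis
  proof (intro exI[of _ C] conjI allI impI)
    show C: "C > 0" unfolding C_def using C1 \<omega> by simp
    fix g :: "'a \<Rightarrow> ennreal" and l :: real
    assume "l > 0 \<and> g \<in> borel_measurable lebesgue"
    then have l: "l > 0" and g: "g \<in> borel_measurable lebesgue" by auto
    define I where "I = {(y, r). r > 0 \<and>
        ennreal (l * measure lebesgue (ball y r)) \<le> (\<integral>\<^sup>+z\<in>ball y r. g z \<partial>lebesgue)}"
    have mB: "(\<lambda>z. g z * indicator (ball y r) z) \<in> borel_measurable lebesgue" for y r
      by (intro borel_measurable_times_ennreal g borel_measurable_indicator) simp
    show "\<exists>h \<in> borel_measurable lebesgue.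
       (\<integral>\<^sup>+x. h x \<partial>lebesgue) \<le> ennreal (C / l) * (\<integral>\<^sup>+x. g x \<partial>lebesgue) \<and>
       (\<forall>x y r. (y, r) \<in> Gamma_region \<alpha> x \<and>
          ennreal (l * measure lebesgue (ball y r)) \<le> (\<integral>\<^sup>+z\<in>ball y r. g z \<partial>lebesgue)
          \<longrightarrow> ennreal (r powr (\<alpha> * real ?n)) \<le> h x)"
    \<comment> \<open>If \<open>g\<close> has infinite integral, the constant
      \<open>\<infinity>\<close> serves as majorant. Finiteness is needed below to bound the radii,
      which the covering lemma requires.\<close>
    proof (cases "(\<integral>\<^sup>+x. g x \<partial>lebesgue) = \<infinity>")
      case True
      then have "(\<integral>\<^sup>+(x::'a). \<infinity> \<partial>lebesgue) \<le> ennreal (C / l) * (\<integral>\<^sup>+x. g x \<partial>lebesgue)"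
        using C l by (simp add: ennreal_mult_top)
      then show ?thesis by (intro bexI[of _ "\<lambda>_. \<infinity>"]) auto
    next
      case False
      define G where "G = enn2real (\<integral>\<^sup>+x. g x \<partial>lebesgue)"
      have G: "(\<integral>\<^sup>+x. g x \<partial>lebesgue) = ennreal G" "G \<ge> 0"
        using False unfolding G_def by (auto simp: less_top)
      \<comment> \<open>Comparing the average with the total integral bounds \<open>r ^ n\<close>.
        This bounds \<open>r\<close> itself only when \<open>r > 1\<close>, hence the maximum with
        1.\<close>
      define B where "B = max 1 (G / (l * \<omega>))"
      have bdd: "0 < snd i \<and> snd i \<le> B" if i: "i \<in> I" for i
      proof -
        obtain y r where yr: "i = (y, r)" by fastforce
        have r: "r > 0" using i yr unfolding I_def by auto
        have "ennreal (l * measure lebesgue (ball y r)) \<le> (\<integral>\<^sup>+z\<in>ball y r. g z \<partial>lebesgue)"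
          using i yr unfolding I_def by auto
        also have "\<dots> \<le> (\<integral>\<^sup>+z. g z \<partial>lebesgue)"
          by (intro nn_integral_mono) (auto simp: indicator_def)
        finally have "l * measure lebesgue (ball y r) \<le> G"
          using G by simp
        then have "l * (\<omega> * r ^ ?n) \<le> G"
          using r by (simp add: content_ball \<omega>_def)
        then have *: "r ^ ?n \<le> G / (l * \<omega>)"
          using l \<omega> by (simp add: field_simps)
        have "r \<le> B"
        proof (cases "r \<le> 1")
          case False
          then have "r \<le> r ^ ?n" by (intro self_le_power) auto
          with * show ?thesis unfolding B_def by simp
        qed (simp add: B_def)
        with r yr show ?thesis by simp
      qed
      obtain J where J: "countable J" "J \<subseteq> I"
        and disj: "pairwise (\<lambda>i j. disjnt (cball (fst i) (snd i)) (cball (fst j) (snd j))) J"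
        and cov: "\<And>i. i \<in> I \<Longrightarrow> \<exists>j. j \<in> J \<and>
            \<not> disjnt (cball (fst i) (snd i)) (cball (fst j) (snd j)) \<and>
            cball (fst i) (snd i) \<subseteq> ball (fst j) (5 * snd j)"
        using Vitali_covering_lemma_cballs_balls[of I snd B fst] bdd by blast
      have Jpos: "snd j > 0" if "j \<in> J" for j using bdd that J by blast
      have "\<forall>j\<in>J. \<exists>K. K \<in> borel_measurable lebesgue \<and>
         (\<integral>\<^sup>+x. K x \<partial>lebesgue) \<le> ennreal (C1 * (5 * snd j) ^ ?n) \<and>
         (\<forall>x y r. (y, r) \<in> Gamma_region \<alpha> x \<and> ball y r \<subseteq> ball (fst j) (5 * snd j)
          \<longrightarrow> ennreal (r powr (\<alpha> * real ?n)) \<le> K x)"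
        using tent Jpos by (metis mult_pos_pos zero_less_numeral)
      then obtain K where mK: "\<And>j. j \<in> J \<Longrightarrow> K j \<in> borel_measurable lebesgue"
        and IK: "\<And>j. j \<in> J \<Longrightarrow> (\<integral>\<^sup>+x. K j x \<partial>lebesgue) \<le> ennreal (C1 * (5 * snd j) ^ ?n)"
        and K: "\<And>j x y r. \<lbrakk>j \<in> J; (y, r) \<in> Gamma_region \<alpha> x; ball y r \<subseteq> ball (fst j) (5 * snd j)\<rbrakk>
           \<Longrightarrow> ennreal (r powr (\<alpha> * real ?n)) \<le> K j x"
        by metis
      define h where "h x = (\<integral>\<^sup>+j. K j x \<partial>count_space J)" for x
      have mh: "h \<in> borel_measurable lebesgue"
        unfolding h_def using J mK by (intro borel_measurable_nn_integral_count_space)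
      have dfam: "disjoint_family_on (\<lambda>j. ball (fst j) (snd j)) J"
        unfolding disjoint_family_on_def
      proof (intro ballI impI)
        fix i j assume "i \<in> J" "j \<in> J" "i \<noteq> j"
        then have "cball (fst i) (snd i) \<inter> cball (fst j) (snd j) = {}"
          using disj unfolding pairwise_def disjnt_def by blast
        then show "ball (fst i) (snd i) \<inter> ball (fst j) (snd j) = {}"
          using ball_subset_cball by blast
      qed
      have "(\<integral>\<^sup>+x. h x \<partial>lebesgue) = (\<integral>\<^sup>+j. \<integral>\<^sup>+x. K j x \<partial>lebesgue \<partial>count_space J)"
        unfolding h_def using J mK by (intro nn_integral_count_space_nn_integral)
      also have "\<dots> \<le> (\<integral>\<^sup>+j. \<integral>\<^sup>+x. ennreal (C / l) * (g x * indicator (ball (fst j) (snd j)) x) \<partial>lebesgue \<partial>count_space J)"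
      proof (rule nn_integral_mono)
        fix j assume "j \<in> space (count_space J)"
        then have j: "j \<in> J" by simp
        have "(\<integral>\<^sup>+x. K j x \<partial>lebesgue) \<le> ennreal (C1 * (5 * snd j) ^ ?n)" using IK j by blast
        also have "C1 * (5 * snd j) ^ ?n = C / l * (l * measure lebesgue (ball (fst j) (snd j)))"
          using l \<omega> Jpos[OF j] unfolding C_def
          by (simp add: content_ball \<omega>_def[symmetric] power_mult_distrib)
        also have "ennreal \<dots> = ennreal (C / l) * ennreal (l * measure lebesgue (ball (fst j) (snd j)))"
          using C l by (intro ennreal_mult) auto
        also have "\<dots> \<le> ennreal (C / l) * (\<integral>\<^sup>+z\<in>ball (fst j) (snd j). g z \<partial>lebesgue)"
          using j J unfolding I_def by (intro mult_left_mono) auto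
        also have "\<dots> = (\<integral>\<^sup>+x. ennreal (C / l) * (g x * indicator (ball (fst j) (snd j)) x) \<partial>lebesgue)"
          by (intro nn_integral_cmult[symmetric] mB)
        finally show "(\<integral>\<^sup>+x. K j x \<partial>lebesgue)
          \<le> (\<integral>\<^sup>+x. ennreal (C / l) * (g x * indicator (ball (fst j) (snd j)) x) \<partial>lebesgue)" .
      qed
      \<comment> \<open>Sum and integral are exchanged back, so that disjointness can be used at
        each point \<open>x\<close>.\<close>
      also have "\<dots> = (\<integral>\<^sup>+x. \<integral>\<^sup>+j. ennreal (C / l) * (g x * indicator (ball (fst j) (snd j)) x) \<partial>count_space J \<partial>lebesgue)"
        by (intro nn_integral_count_space_nn_integral[symmetric] J borel_measurable_times_ennreal[OF _ mB]) simp
      also have "\<dots> \<le> (\<integral>\<^sup>+x. ennreal (C / l) * g x \<partial>lebesgue)"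
        using nn_integral_count_space_disjoint_le[OF dfam]
        by (intro nn_integral_mono) (simp add: mult.assoc[symmetric])
      also have "\<dots> = ennreal (C / l) * (\<integral>\<^sup>+x. g x \<partial>lebesgue)"
        by (intro nn_integral_cmult g)
      finally have Ih: "(\<integral>\<^sup>+x. h x \<partial>lebesgue) \<le> ennreal (C / l) * (\<integral>\<^sup>+x. g x \<partial>lebesgue)" .
      have "ennreal (r powr (\<alpha> * real ?n)) \<le> h x"
        if xyr: "(y, r) \<in> Gamma_region \<alpha> x"
          and avg: "ennreal (l * measure lebesgue (ball y r)) \<le> (\<integral>\<^sup>+z\<in>ball y r. g z \<partial>lebesgue)"
        for x y r
      proof -
        have "(y, r) \<in> I" using xyr avg unfolding I_def Gamma_region_def by auto
        from cov[OF this] obtain j where j: "j \<in> J" "cball y r \<subseteq> ball (fst j) (5 * snd j)"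
          by auto
        then have "ball y r \<subseteq> ball (fst j) (5 * snd j)"
          using ball_subset_cball by blast
        then have "ennreal (r powr (\<alpha> * real ?n)) \<le> K j x"
          using K xyr j by blast
        also have "\<dots> \<le> h x" unfolding h_def by (rule nn_integral_ge_point[OF j(1)])
        finally show ?thesis .
      qed
      with mh Ih show ?thesis by blast
    qed
  qed
qed

section \<open>Strong-type estimate by summing over dyadic heights\<close>

text \<open>The indices that contribute are those up to \<open>\<lceil>log 2 v\<rceil>\<close>. Read
  downwards from the top one, the terms form a geometric series with ratio
  \<open>2 powr - q\<close>, and its first term is at most \<open>v powr q\<close>.\<close>

lemma dyadic_geometric_sum_le:
  fixes q v :: real
  assumes q: "q > 0" and v: "v \<ge> 0"
  shows "(\<integral>\<^sup>+k. ennreal (2 powr ((real_of_int k - 1) * q)) * indicator {k. 2 powr (real_of_int k - 1) < v} k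
           \<partial>count_space UNIV) \<le> ennreal (v powr q / (1 - 2 powr - q))"
proof (cases "v = 0")
  case True
  then have "{k::int. 2 powr (real_of_int k - 1) < v} = {}" by (auto simp: not_less)
  then show ?thesis by simp
next
  case False
  with v have v: "v > 0" by simp
  define k0 where "k0 = \<lceil>log 2 v\<rceil>"
  have less_iff: "2 powr (real_of_int k - 1) < v \<longleftrightarrow> k \<le> k0" for k :: int
  proof -
    have "2 powr (real_of_int k - 1) < v \<longleftrightarrow> real_of_int k - 1 < log 2 v"
      using v by (simp add: less_log_iff)
    also have "\<dots> \<longleftrightarrow> k \<le> k0" unfolding k0_def by linarith
    finally show ?thesis .
  qed
  define \<rho> where "\<rho> = 2 powr - q"
  have \<rho>: "0 < \<rho>" "\<rho> < 1" unfolding \<rho>_def using q by (auto simp: powr_less_one)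
  define b where "b = 2 powr ((real_of_int k0 - 1) * q)"
  have bij: "bij_betw (\<lambda>n. k0 - int n) UNIV {..k0}"
    by (rule bij_betw_byWitness[where f' = "\<lambda>k. nat (k0 - k)"]) auto
  have "(\<integral>\<^sup>+k. ennreal (2 powr ((real_of_int k - 1) * q)) * indicator {k. 2 powr (real_of_int k - 1) < v} k
           \<partial>count_space UNIV)
      = (\<integral>\<^sup>+k. ennreal (2 powr ((real_of_int k - 1) * q)) \<partial>count_space {..k0})"
    unfolding less_iff atMost_def[symmetric] by (simp add: nn_integral_count_space_indicator)
  also have "\<dots> = (\<Sum>n. ennreal (2 powr ((real_of_int (k0 - int n) - 1) * q)))"
    by (simp add: nn_integral_bij_count_space[symmetric, OF bij] nn_integral_count_space_nat)
  also have "\<dots> = (\<Sum>n. ennreal (b * \<rho> ^ n))"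
  proof (intro suminf_cong arg_cong[where f = ennreal])
    fix n
    have "\<rho> ^ n = 2 powr (- q * real n)"
      unfolding \<rho>_def using powr_realpow[of "2 powr - q" n] by (simp add: powr_powr)
    then show "2 powr ((real_of_int (k0 - int n) - 1) * q) = b * \<rho> ^ n"
      unfolding b_def by (simp add: powr_add[symmetric] algebra_simps)
  qed
  also have "\<dots> = ennreal (b * (1 / (1 - \<rho>)))"
    using \<rho> b_def by (intro suminf_ennreal_eq sums_mult geometric_sums) auto
  also have "\<dots> \<le> ennreal (v powr q / (1 - \<rho>))"
  proof -
    have "b = (2 powr (real_of_int k0 - 1)) powr q" unfolding b_def by (simp add: powr_powr)
    also have "\<dots> \<le> v powr q" using less_iff[of k0] q by (intro powr_mono2) auto
    finally show ?thesis using \<rho> by (intro ennreal_leI) (simp add: divide_right_mono)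
  qed
  finally show ?thesis unfolding \<rho>_def .
qed

text \<open>Marcinkiewicz interpolation with majorants. If
  \<open>2 powr k < A \<le> 2 powr (k + 1)\<close>, then discarding the values of
  \<open>\<bar>w\<bar>\<close> up to \<open>l k\<close>, half of \<open>2 powr k\<close>, leaves a
  function \<open>g k\<close> whose average is still at least \<open>l k\<close>. The weak-type
  majorant \<open>h k\<close> of \<open>g k\<close> therefore controls the weight, and
  \<open>H\<close> sums the \<open>h k\<close> with factors that dominate
  \<open>A powr p\<close>.\<close>

lemma strong_majorant:
  fixes \<alpha> p :: real
  assumes p: "p > 1"
  shows "\<exists>C>0. \<forall>w::'a::euclidean_space \<Rightarrow> real. w \<in> borel_measurable lebesgue \<longrightarrow>
       (\<exists>H \<in> borel_measurable lebesgue.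
       (\<integral>\<^sup>+x. H x \<partial>lebesgue) \<le> ennreal C * (\<integral>\<^sup>+x. ennreal (\<bar>w x\<bar> powr p) \<partial>lebesgue) \<and>
       (\<forall>x y r A. (y, r) \<in> Gamma_region \<alpha> x \<and> A \<ge> 0 \<and>
          (\<integral>\<^sup>+z\<in>ball y r. ennreal \<bar>w z\<bar> \<partial>lebesgue) = ennreal (A * measure lebesgue (ball y r))
          \<longrightarrow> ennreal (r powr (\<alpha> * real DIM('a)) * A powr p) \<le> H x))"
proof -
  let ?n = "DIM('a)"
  obtain C0 where C0: "C0 > 0"
    and level: "\<And>(g::'a \<Rightarrow> ennreal) l. \<lbrakk>l > 0; g \<in> borel_measurable lebesgue\<rbrakk> \<Longrightarrow>
       \<exists>h \<in> borel_measurable lebesgue.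
       (\<integral>\<^sup>+x. h x \<partial>lebesgue) \<le> ennreal (C0 / l) * (\<integral>\<^sup>+x. g x \<partial>lebesgue) \<and>
       (\<forall>x y r. (y, r) \<in> Gamma_region \<alpha> x \<and>
          ennreal (l * measure lebesgue (ball y r)) \<le> (\<integral>\<^sup>+z\<in>ball y r. g z \<partial>lebesgue)
          \<longrightarrow> ennreal (r powr (\<alpha> * real ?n)) \<le> h x)"
    using level_set_majorant[where 'a = 'a and \<alpha> = \<alpha>] by blast
  \<comment> \<open>The denominator of the geometric series with exponent \<open>p - 1\<close>; it
    is positive because \<open>p > 1\<close>.\<close>
  define D where "D = 1 - 2 powr - (p - 1)"
  have D: "D > 0" unfolding D_def using p powr_less_one[of 2 "- (p - 1)"] by simp
  define C where "C = C0 * 2 powr (2 * p) / D"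
  show ?thesis
  proof (intro exI[of _ C] conjI allI impI)
    show C: "C > 0" unfolding C_def using C0 D by simp
    fix w :: "'a \<Rightarrow> real"
    assume w[measurable]: "w \<in> borel_measurable lebesgue"
    define l where "l k = 2 powr (real_of_int k - 1)" for k :: int
    have l: "l k > 0" for k unfolding l_def by simp
    define c where "c k = 2 powr ((real_of_int k + 1) * p)" for k :: int
    have c: "c k > 0" for k unfolding c_def by simp
    define g where "g k z = ennreal \<bar>w z\<bar> * indicator {k. l k < \<bar>w z\<bar>} k" for k z
    have mg: "g k \<in> borel_measurable lebesgue" for k
    proof -
      have "g k = (\<lambda>z. ennreal (if l k < \<bar>w z\<bar> then \<bar>w z\<bar> else 0))"
        unfolding g_def by (auto simp: fun_eq_iff)
      then show ?thesis by simp
    qed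
    have "\<forall>k. \<exists>h. h \<in> borel_measurable lebesgue \<and>
       (\<integral>\<^sup>+x. h x \<partial>lebesgue) \<le> ennreal (C0 / l k) * (\<integral>\<^sup>+x. g k x \<partial>lebesgue) \<and>
       (\<forall>x y r. (y, r) \<in> Gamma_region \<alpha> x \<and>
          ennreal (l k * measure lebesgue (ball y r)) \<le> (\<integral>\<^sup>+z\<in>ball y r. g k z \<partial>lebesgue)
          \<longrightarrow> ennreal (r powr (\<alpha> * real ?n)) \<le> h x)"
      using level[OF l mg] by blast
    then obtain h where mh: "\<And>k. h k \<in> borel_measurable lebesgue"
      and Ih: "\<And>k. (\<integral>\<^sup>+x. h k x \<partial>lebesgue) \<le> ennreal (C0 / l k) * (\<integral>\<^sup>+x. g k x \<partial>lebesgue)"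
      and h: "\<And>k x y r. \<lbrakk>(y, r) \<in> Gamma_region \<alpha> x;
          ennreal (l k * measure lebesgue (ball y r)) \<le> (\<integral>\<^sup>+z\<in>ball y r. g k z \<partial>lebesgue)\<rbrakk>
          \<Longrightarrow> ennreal (r powr (\<alpha> * real ?n)) \<le> h k x"
      by metis
    define H where "H x = (\<integral>\<^sup>+k. ennreal (c k) * h k x \<partial>count_space UNIV)" for x
    have mch: "(\<lambda>x. ennreal (c k) * h k x) \<in> borel_measurable lebesgue" for k
      using mh by simp
    have mH: "H \<in> borel_measurable lebesgue"
      unfolding H_def using mch by (intro borel_measurable_nn_integral_count_space) auto
    \<comment> \<open>At a fixed \<open>z\<close> only heights with
      \<open>l k < \<bar>w z\<bar>\<close> count. The coefficient is a constant times
      \<open>(l k) powr (p - 1)\<close>, so the sum over them is of order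
      \<open>\<bar>w z\<bar> powr (p - 1)\<close>, and the factor \<open>\<bar>w z\<bar>\<close> of
      \<open>g k\<close> completes the power \<open>p\<close>.\<close>
    have kernel: "(\<integral>\<^sup>+k. ennreal (c k * C0 / l k) * g k z \<partial>count_space UNIV) \<le> ennreal C * ennreal (\<bar>w z\<bar> powr p)" for z
    proof -
      \<comment> \<open>Exponents:
        \<open>(k + 1) * p - (k - 1) = 2 * p + (k - 1) * (p - 1)\<close>.\<close>
      have cl: "c k * C0 / l k = C0 * 2 powr (2 * p) * 2 powr ((real_of_int k - 1) * (p - 1))" for k
        unfolding c_def l_def
        by (simp add: field_simps flip: powr_add)
      have "(\<integral>\<^sup>+k. ennreal (c k * C0 / l k) * g k z \<partial>count_space UNIV)
        = (\<integral>\<^sup>+k. ennreal (C0 * 2 powr (2 * p) * \<bar>w z\<bar>) * (ennreal (2 powr ((real_of_int k - 1) * (p - 1))) *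
            indicator {k. 2 powr (real_of_int k - 1) < \<bar>w z\<bar>} k) \<partial>count_space UNIV)"
        unfolding cl unfolding g_def l_def using C0
        by (intro nn_integral_cong) (simp add: ennreal_mult mult_ac)
      also have "\<dots> = ennreal (C0 * 2 powr (2 * p) * \<bar>w z\<bar>) * (\<integral>\<^sup>+k. ennreal (2 powr ((real_of_int k - 1) * (p - 1))) *
            indicator {k. 2 powr (real_of_int k - 1) < \<bar>w z\<bar>} k \<partial>count_space UNIV)"
        by (intro nn_integral_cmult) auto
      also have "\<dots> \<le> ennreal (C0 * 2 powr (2 * p) * \<bar>w z\<bar>) * ennreal (\<bar>w z\<bar> powr (p - 1) / D)"
        unfolding D_def using p by (intro mult_left_mono dyadic_geometric_sum_le) auto
      also have "\<dots> = ennreal (C * (\<bar>w z\<bar> * \<bar>w z\<bar> powr (p - 1)))"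
        unfolding C_def using C0 D by (simp add: ennreal_mult[symmetric] mult_ac)
      also have "\<bar>w z\<bar> * \<bar>w z\<bar> powr (p - 1) = \<bar>w z\<bar> powr p"
        by (cases "w z = 0") (auto simp: powr_diff)
      finally show ?thesis using C by (simp add: ennreal_mult)
    qed
    have "(\<integral>\<^sup>+x. H x \<partial>lebesgue) = (\<integral>\<^sup>+k. \<integral>\<^sup>+x. ennreal (c k) * h k x \<partial>lebesgue \<partial>count_space UNIV)"
      unfolding H_def by (intro nn_integral_count_space_nn_integral mch) auto
    also have "\<dots> \<le> (\<integral>\<^sup>+k. \<integral>\<^sup>+x. ennreal (c k * C0 / l k) * g k x \<partial>lebesgue \<partial>count_space UNIV)"
    proof (rule nn_integral_mono)
      fix k :: int
      have "(\<integral>\<^sup>+x. ennreal (c k) * h k x \<partial>lebesgue) = ennreal (c k) * (\<integral>\<^sup>+x. h k x \<partial>lebesgue)"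
        by (intro nn_integral_cmult mh)
      also have "\<dots> \<le> ennreal (c k) * (ennreal (C0 / l k) * (\<integral>\<^sup>+x. g k x \<partial>lebesgue))"
        by (intro mult_left_mono Ih) auto
      also have "\<dots> = ennreal (c k * C0 / l k) * (\<integral>\<^sup>+x. g k x \<partial>lebesgue)"
        using c[of k] C0 l[of k] by (simp add: ennreal_mult[symmetric] mult.assoc[symmetric])
      also have "\<dots> = (\<integral>\<^sup>+x. ennreal (c k * C0 / l k) * g k x \<partial>lebesgue)"
        by (intro nn_integral_cmult[symmetric] mg)
      finally show "(\<integral>\<^sup>+x. ennreal (c k) * h k x \<partial>lebesgue) \<le> (\<integral>\<^sup>+x. ennreal (c k * C0 / l k) * g k x \<partial>lebesgue)" .
    qed
    also have "\<dots> = (\<integral>\<^sup>+x. \<integral>\<^sup>+k. ennreal (c k * C0 / l k) * g k x \<partial>count_space UNIV \<partial>lebesgue)"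
      by (intro nn_integral_count_space_nn_integral[symmetric] borel_measurable_times_ennreal mg) auto
    also have "\<dots> \<le> (\<integral>\<^sup>+x. ennreal C * ennreal (\<bar>w x\<bar> powr p) \<partial>lebesgue)"
      by (rule nn_integral_mono, rule kernel)
    also have "\<dots> = ennreal C * (\<integral>\<^sup>+x. ennreal (\<bar>w x\<bar> powr p) \<partial>lebesgue)"
      by (intro nn_integral_cmult) measurable
    finally have IH: "(\<integral>\<^sup>+x. H x \<partial>lebesgue) \<le> ennreal C * (\<integral>\<^sup>+x. ennreal (\<bar>w x\<bar> powr p) \<partial>lebesgue)" .
    have "ennreal (r powr (\<alpha> * real ?n) * A powr p) \<le> H x"
      if xyr: "(y, r) \<in> Gamma_region \<alpha> x" and A0: "A \<ge> 0"
        and A: "(\<integral>\<^sup>+z\<in>ball y r. ennreal \<bar>w z\<bar> \<partial>lebesgue) = ennreal (A * measure lebesgue (ball y r))"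
      for x y r A
    proof (cases "A = 0")
      case False
      with A0 have A0: "A > 0" by simp
      \<comment> \<open>The ceiling minus 1 makes the lower bound on \<open>A\<close> strict and the
        upper one non-strict, also when \<open>A\<close> is a power of 2.\<close>
      define k where "k = \<lceil>log 2 A\<rceil> - 1"
      have "real_of_int k < log 2 A" "log 2 A \<le> real_of_int k + 1"
        unfolding k_def by linarith+
      then have k: "2 powr real_of_int k < A" "A \<le> 2 powr (real_of_int k + 1)"
        using A0 by (auto simp: less_log_iff log_le_iff)
      have lk: "2 powr real_of_int k = l k + l k" unfolding l_def by (simp add: powr_diff)
      define V where "V = measure lebesgue (ball y r)"
      have V: "V \<ge> 0" unfolding V_def by simp
      have EV: "emeasure lebesgue (ball y r) = ennreal V"
        using xyr unfolding V_def Gamma_region_def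
        by (simp add: emeasure_ball content_ball)
      \<comment> \<open>Since \<open>A\<close> exceeds \<open>2 * l k\<close> and
        \<open>\<bar>w\<bar>\<close> is at most \<open>g k + l k\<close>, one copy of
        \<open>l k * V\<close> pays for the discarded part and cancels; the other bounds the
        integral of \<open>g k\<close> from below.\<close>
      have "ennreal (l k * V) + ennreal (l k * V) \<le> ennreal (A * V)"
        using k lk V l[of k] by (subst ennreal_plus[symmetric]) (auto simp: distrib_right[symmetric] intro!: ennreal_leI mult_right_mono)
      also have "\<dots> = (\<integral>\<^sup>+z\<in>ball y r. ennreal \<bar>w z\<bar> \<partial>lebesgue)" using A V_def by simp
      also have "\<dots> \<le> (\<integral>\<^sup>+z. g k z * indicator (ball y r) z + ennreal (l k) * indicator (ball y r) z \<partial>lebesgue)"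
        by (intro nn_integral_mono) (auto simp: g_def indicator_def not_less intro!: ennreal_leI)
      also have "\<dots> = (\<integral>\<^sup>+z\<in>ball y r. g k z \<partial>lebesgue) + (\<integral>\<^sup>+z. ennreal (l k) * indicator (ball y r) z \<partial>lebesgue)"
        by (intro nn_integral_add borel_measurable_times_ennreal mg borel_measurable_indicator) auto
      also have "(\<integral>\<^sup>+z. ennreal (l k) * indicator (ball y r) z \<partial>lebesgue) = ennreal (l k * V)"
        using l[of k] V EV by (simp add: nn_integral_cmult_indicator ennreal_mult del: emeasure_completion)
      finally have "ennreal (l k * V) \<le> (\<integral>\<^sup>+z\<in>ball y r. g k z \<partial>lebesgue)"
        by (simp add: add.commute)
      then have "ennreal (r powr (\<alpha> * real ?n)) \<le> h k x"
        using h[OF xyr] V_def by simp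
      moreover have "A powr p \<le> c k"
        using powr_mono2[OF _ _ k(2), of p] A0 p unfolding c_def by (simp add: powr_powr)
      ultimately have "ennreal (A powr p) * ennreal (r powr (\<alpha> * real ?n)) \<le> ennreal (c k) * h k x"
        by (intro mult_mono ennreal_leI) auto
      also have "\<dots> \<le> H x" unfolding H_def by (rule nn_integral_ge_point) simp
      finally show ?thesis by (simp add: ennreal_mult[symmetric] mult.commute)
    qed simp
    with mH IH show "\<exists>H \<in> borel_measurable lebesgue.
       (\<integral>\<^sup>+x. H x \<partial>lebesgue) \<le> ennreal C * (\<integral>\<^sup>+x. ennreal (\<bar>w x\<bar> powr p) \<partial>lebesgue) \<and>
       (\<forall>x y r A. (y, r) \<in> Gamma_region \<alpha> x \<and> A \<ge> 0 \<and>
          (\<integral>\<^sup>+z\<in>ball y r. ennreal \<bar>w z\<bar> \<partial>lebesgue) = ennreal (A * measure lebesgue (ball y r))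
          \<longrightarrow> ennreal (r powr (\<alpha> * real ?n) * A powr p) \<le> H x)"
      by blast
  qed
qed

section \<open>Measurability of the maximal function\<close>

text \<open>A pair on the boundary of the region of \<open>x\<close> may leave it when
  \<open>x\<close> moves, so it is first replaced. By monotone convergence a slightly smaller
  concentric ball still gives a value above \<open>l\<close>. Moving the centre a little towards
  \<open>x\<close>, with radius \<open>r\<close> kept, yields a ball that contains the smaller one
  and satisfies the aperture condition strictly. It is then admissible for all points near
  \<open>x\<close>.\<close>

lemma open_max_op_superlevel:
  fixes w :: "'a::euclidean_space \<Rightarrow> real"
  assumes w: "w \<in> borel_measurable lebesgue"
  shows "open {x. l < max_op \<alpha> \<beta> w x}"
  unfolding open_contains_ball
proof
  fix x assume "x \<in> {x. l < max_op \<alpha> \<beta> w x}"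
  \<comment> \<open>The prefactor depends on the radius alone, so it is unchanged when the centre
    moves.\<close>
  define c where "c r = ennreal (1 / measure lebesgue (ball (0::'a) r) powr (1 - 2 * \<beta> / real DIM('a)))" for r
  define I where "I y r = (\<integral>\<^sup>+z\<in>ball y r. ennreal \<bar>w z\<bar> \<partial>lebesgue)" for y r
  have c: "ennreal (1 / measure lebesgue (ball y r) powr (1 - 2 * \<beta> / real DIM('a))) = c r"
    if "r > 0" for y :: 'a and r
    using that unfolding c_def by (simp add: content_ball)
  from \<open>x \<in> _\<close> obtain y r where yr: "(y, r) \<in> Gamma_region \<alpha> x" and
    "l < ennreal (1 / measure lebesgue (ball y r) powr (1 - 2 * \<beta> / real DIM('a))) * I y r"
    unfolding max_op_def I_def by (auto simp: less_SUP_iff)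
  moreover have r: "r > 0" "r powr \<alpha> \<le> 1" and d: "dist y x \<le> r powr (1 - \<alpha>)"
    using yr unfolding Gamma_region_def by auto
  ultimately have lt: "l < c r * I y r" using c by simp
  define s where "s n = r - r / real (Suc n)" for n
  have s: "s n < r" for n unfolding s_def using r by simp
  have "incseq s" unfolding s_def using r by (auto simp: incseq_def field_simps)
  have "I y r = (\<integral>\<^sup>+z. (SUP n. ennreal \<bar>w z\<bar> * indicator (ball y (s n)) z) \<partial>lebesgue)"
    unfolding I_def
  proof (rule nn_integral_cong)
    fix z
    have "(indicator (ball y r) z :: ennreal) = (SUP n. indicator (ball y (s n)) z)"
    proof (cases "dist y z < r")
      case True
      have "s \<longlonglongrightarrow> r - 0" unfolding s_def
        by (intro tendsto_diff tendsto_const LIMSEQ_Suc[OF lim_const_over_n])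
      then have "\<forall>\<^sub>F n in sequentially. dist y z < s n"
        using True by (intro order_tendstoD(1)) auto
      then obtain n where "dist y z < s n" by (auto simp: eventually_sequentially)
      then have "(indicator (ball y (s n)) z :: ennreal) = 1" by simp
      then have "1 \<le> (SUP n. indicator (ball y (s n)) z :: ennreal)"
        by (metis SUP_upper UNIV_I)
      moreover have "(SUP n. indicator (ball y (s n)) z :: ennreal) \<le> 1"
        by (intro SUP_least) (simp add: indicator_def)
      ultimately show ?thesis using True by simp
    next
      case False
      then have "\<not> dist y z < s n" for n using s[of n] by linarith
      then show ?thesis using False by simp
    qed
    then show "ennreal \<bar>w z\<bar> * indicator (ball y r) z = (SUP n. ennreal \<bar>w z\<bar> * indicator (ball y (s n)) z)"
      by (simp add: SUP_mult_left_ennreal)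
  qed
  also have "\<dots> = (SUP n. I y (s n))" unfolding I_def
  proof (rule nn_integral_monotone_convergence_SUP)
    show "incseq (\<lambda>n z. ennreal \<bar>w z\<bar> * indicator (ball y (s n)) z)"
      using \<open>incseq s\<close> by (auto simp: incseq_def le_fun_def indicator_def intro: less_le_trans)
    show "(\<lambda>z. ennreal \<bar>w z\<bar> * indicator (ball y (s n)) z) \<in> borel_measurable lebesgue" for n
      using w by (intro borel_measurable_times_ennreal borel_measurable_indicator) auto
  qed
  finally have "l < (SUP n. c r * I y (s n))" using lt by (simp add: SUP_mult_left_ennreal)
  then obtain n where n: "l < c r * I y (s n)" by (auto simp: less_SUP_iff)
  define D where "D = dist y x"
  \<comment> \<open>The bound 1 keeps \<open>y'\<close> on the segment from \<open>y\<close> to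
    \<open>x\<close>. The quotient makes the shift \<open>\<theta> * D\<close> at most
    \<open>r - s n\<close>; its denominator \<open>D + 1\<close> also allows
    \<open>D = 0\<close>.\<close>
  define \<theta> where "\<theta> = min 1 ((r - s n) / (D + 1))"
  have D: "D \<ge> 0" "D \<le> r powr (1 - \<alpha>)" unfolding D_def using d by auto
  have \<theta>: "0 < \<theta>" "\<theta> \<le> 1" "\<theta> * D \<le> r - s n"
  proof -
    show "0 < \<theta>" "\<theta> \<le> 1" unfolding \<theta>_def using s[of n] D by auto
    have "\<theta> * D \<le> (r - s n) / (D + 1) * D" unfolding \<theta>_def using D by (intro mult_right_mono) auto
    also have "\<dots> \<le> r - s n" using D s[of n] by (simp add: field_simps)
    finally show "\<theta> * D \<le> r - s n" .
  qed
  define y' where "y' = y + \<theta> *\<^sub>R (x - y)"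
  have "dist y y' = \<theta> * D"
    unfolding y'_def D_def using \<theta> by (simp add: dist_norm norm_minus_commute)
  then have "ball y (s n) \<subseteq> ball y' r" using \<theta> by (simp add: ball_subset_ball_iff)
  then have II: "I y (s n) \<le> I y' r"
    unfolding I_def by (intro nn_integral_mono) (auto simp: indicator_def)
  have "dist y' x = (1 - \<theta>) * D"
  proof -
    have "y' - x = (1 - \<theta>) *\<^sub>R (y - x)" unfolding y'_def by (simp add: algebra_simps)
    then show ?thesis unfolding D_def dist_norm using \<theta> by simp
  qed
  then have y'x: "dist y' x < r powr (1 - \<alpha>)"
  proof (cases "D = 0")
    case False
    with D \<theta> have "0 < \<theta> * D" by simp
    with D \<open>dist y' x = _\<close> show ?thesis by (simp add: left_diff_distrib)
  qed (use r \<open>dist y' x = _\<close> in simp)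
  have "ball x (r powr (1 - \<alpha>) - dist y' x) \<subseteq> {x. l < max_op \<alpha> \<beta> w x}"
  proof
    fix x' assume "x' \<in> ball x (r powr (1 - \<alpha>) - dist y' x)"
    then have "dist y' x' \<le> r powr (1 - \<alpha>)" using dist_triangle[of y' x' x] by simp
    then have mem: "(y', r) \<in> Gamma_region \<alpha> x'" using r unfolding Gamma_region_def by simp
    have "l < c r * I y' r" using n II by (meson less_le_trans mult_left_mono zero_le)
    also have "\<dots> \<le> max_op \<alpha> \<beta> w x'"
      unfolding max_op_def using c[OF r(1), of y'] by (intro SUP_upper2[OF mem]) (simp add: I_def)
    finally show "x' \<in> {x. l < max_op \<alpha> \<beta> w x}" by simp
  qed
  then show "\<exists>e>0. ball x e \<subseteq> {x. l < max_op \<alpha> \<beta> w x}"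
    using y'x by (intro exI[of _ "r powr (1 - \<alpha>) - dist y' x"]) simp
qed

lemma borel_measurable_max_op:
  fixes w :: "'a::euclidean_space \<Rightarrow> real"
  assumes "w \<in> borel_measurable lebesgue"
  shows "max_op \<alpha> \<beta> w \<in> borel_measurable lebesgue"
proof (rule borel_measurableI_greater)
  fix l
  have "{x. l < max_op \<alpha> \<beta> w x} \<in> sets lborel"
    using open_max_op_superlevel[OF assms] by simp
  then show "{x \<in> space lebesgue. l < max_op \<alpha> \<beta> w x} \<in> sets lebesgue" by simp
qed

section \<open>Extended powers and Hoelder's inequality on balls\<close>

lemma enn_powr_mono:
  assumes "a \<le> b" "s > 0"
  shows "enn_powr a s \<le> enn_powr b s"
proof (cases "b = \<infinity>")
  case False
  then have "a < \<infinity>" "b < \<infinity>" using assms(1) by (auto simp: less_top top_unique)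
  then show ?thesis using assms unfolding enn_powr_def
    by (auto intro!: ennreal_leI powr_mono2 enn2real_mono)
qed (simp add: enn_powr_def)

lemma enn_powr_ennreal: "a \<ge> 0 \<Longrightarrow> enn_powr (ennreal a) s = ennreal (a powr s)"
  by (simp add: enn_powr_def)

lemma enn_powr_cancel:
  assumes "s > 0"
  shows "enn_powr (enn_powr a (1 / s)) s = a"
  using assms by (cases a) (simp_all add: enn_powr_def powr_powr)

text \<open>Hoelder's inequality against the indicator of the ball, obtained by integrating a
  pointwise Young inequality \<open>u \<le> b * u powr P + c\<close> that is sharp at
  \<open>u = a\<close>. The choice of \<open>a\<close> makes both terms multiples of
  \<open>N * V powr (1 - 1 / P)\<close>, with weights \<open>1 / P\<close> and
  \<open>1 - 1 / P\<close>.\<close>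

lemma ball_integral_le_Lp:
  fixes w :: "'a::euclidean_space \<Rightarrow> real"
  assumes P: "P > 1" and N: "N \<ge> 0" and r: "r > 0"
    and w[measurable]: "w \<in> borel_measurable lebesgue"
    and int: "(\<integral>\<^sup>+x. ennreal (\<bar>w x\<bar> powr P) \<partial>lebesgue) = ennreal (N powr P)"
  shows "(\<integral>\<^sup>+z\<in>ball y r. ennreal \<bar>w z\<bar> \<partial>lebesgue)
    \<le> ennreal (N * measure lebesgue (ball y r) powr (1 - 1 / P))"
proof -
  define V where "V = measure lebesgue (ball y r)"
  have V: "V > 0" unfolding V_def using measure_lebesgue_ball_pos[OF r] .
  have EV: "emeasure lebesgue (ball y r) = ennreal V"
    unfolding V_def using r by (simp add: emeasure_ball content_ball)
  show ?thesis
  proof (cases "N = 0")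
    case True
    then have "AE x in lebesgue. ennreal (\<bar>w x\<bar> powr P) = 0"
      using int P by (subst nn_integral_0_iff_AE[symmetric]) auto
    then have "AE x in lebesgue. ennreal \<bar>w x\<bar> * indicator (ball y r) x = 0"
      by eventually_elim auto
    then have "(\<integral>\<^sup>+z\<in>ball y r. ennreal \<bar>w z\<bar> \<partial>lebesgue) = (\<integral>\<^sup>+(z::'a). 0 \<partial>lebesgue)"
      by (rule nn_integral_cong_AE)
    then show ?thesis by simp
  next
    case False
    with N have N: "N > 0" by simp
    \<comment> \<open>The constant whose \<open>P\<close>-norm over the ball is \<open>N\<close>. It
      must be positive to be divided by, hence the separate case \<open>N = 0\<close>.\<close>
    define a where "a = N * V powr (- 1 / P)"
    have a: "a > 0" unfolding a_def using N V by simp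
    define b where "b = a powr (1 - P) / P"
    define c where "c = (1 - 1 / P) * a"
    have bc: "b \<ge> 0" "c \<ge> 0" unfolding b_def c_def using a P by auto
    have young: "u \<le> b * u powr P + c" if "u \<ge> 0" for u
    proof -
      have "u / a * 1 \<le> (u / a) powr P / P + 1 powr (P / (P - 1)) / (P / (P - 1))"
        using P a that by (intro Youngs_inequality) (auto simp: field_simps)
      then have "u / a \<le> (u / a) powr P / P + (1 - 1 / P)"
        using P by (simp add: field_simps)
      then have "a * (u / a) \<le> a * ((u / a) powr P / P + (1 - 1 / P))"
        using a by (intro mult_left_mono) auto
      then show ?thesis using a that P unfolding b_def c_def
        by (simp add: powr_divide powr_diff field_simps)
    qed
    have "(\<integral>\<^sup>+z\<in>ball y r. ennreal \<bar>w z\<bar> \<partial>lebesgue)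
        \<le> (\<integral>\<^sup>+z. ennreal b * ennreal (\<bar>w z\<bar> powr P) + ennreal c * indicator (ball y r) z \<partial>lebesgue)"
      using young bc
      by (intro nn_integral_mono)
         (auto simp: indicator_def ennreal_mult[symmetric] ennreal_plus[symmetric] simp del: ennreal_plus intro!: ennreal_leI)
    also have "\<dots> = ennreal b * ennreal (N powr P) + ennreal c * ennreal V"
      using bc V by (subst nn_integral_add) (auto simp: nn_integral_cmult int nn_integral_cmult_indicator EV simp del: emeasure_completion intro!: borel_measurable_times_ennreal borel_measurable_indicator)
    also have "\<dots> = ennreal (b * N powr P + c * V)"
      using bc V by (simp add: ennreal_mult)
    also have "b * N powr P + c * V = N * V powr (1 - 1 / P)"
    proof -
      have "a powr (1 - P) * N powr P = N * V powr (1 - 1 / P)"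
      proof -
        have "a powr (1 - P) = N powr (1 - P) * V powr (- 1 / P * (1 - P))"
          unfolding a_def using N by (simp add: powr_mult powr_powr)
        also have "- 1 / P * (1 - P) = 1 - 1 / P" using P by (simp add: field_simps)
        finally show ?thesis using N by (simp add: powr_diff)
      qed
      moreover have "a * V = N * V powr (1 - 1 / P)"
        unfolding a_def using V by (simp add: powr_diff powr_minus field_simps)
      ultimately show ?thesis unfolding b_def c_def using P by (simp add: field_simps)
    qed
    finally show ?thesis unfolding V_def .
  qed
qed

lemma recip_ennreal: "x > 0 \<Longrightarrow> recip (ennreal x) = 1 / x"
  by (simp add: recip_def inverse_ennreal inverse_eq_divide)

text \<open>For \<open>p = \<infinity>\<close> the average over the ball is a lower bound of the set
  of essential bounds, hence at most its infimum. For finite \<open>p\<close> the norm is raised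
  back to the power \<open>P\<close>.\<close>

lemma ball_integral_le_Lp_norm:
  fixes w :: "'a::euclidean_space \<Rightarrow> real"
  assumes p: "1 < p" and N: "N \<ge> 0" and r: "r > 0"
    and w: "w \<in> borel_measurable lebesgue"
    and norm: "Lp_norm p (\<lambda>x. ennreal \<bar>w x\<bar>) = ennreal N"
  shows "(\<integral>\<^sup>+z\<in>ball y r. ennreal \<bar>w z\<bar> \<partial>lebesgue)
    \<le> ennreal (N * measure lebesgue (ball y r) powr (1 - recip p))"
proof (cases "p = \<infinity>")
  case True
  define V where "V = measure lebesgue (ball y r)"
  have V: "V > 0" unfolding V_def using measure_lebesgue_ball_pos[OF r] .
  have EV: "emeasure lebesgue (ball y r) = ennreal V"
    unfolding V_def using r by (simp add: emeasure_ball content_ball)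
  let ?I = "\<integral>\<^sup>+z\<in>ball y r. ennreal \<bar>w z\<bar> \<partial>lebesgue"
  have "?I / ennreal V \<le> Inf {C. AE x in lebesgue. ennreal \<bar>w x\<bar> \<le> C}"
  proof (rule Inf_greatest)
    fix C assume "C \<in> {C. AE x in lebesgue. ennreal \<bar>w x\<bar> \<le> C}"
    then have "AE x in lebesgue. ennreal \<bar>w x\<bar> \<le> C" by simp
    then have "AE x in lebesgue. ennreal \<bar>w x\<bar> * indicator (ball y r) x \<le> C * indicator (ball y r) x"
      by eventually_elim (simp add: indicator_def)
    then have "?I \<le> (\<integral>\<^sup>+z. C * indicator (ball y r) z \<partial>lebesgue)"
      by (rule nn_integral_mono_AE)
    also have "\<dots> = C * ennreal V"
      by (subst nn_integral_cmult_indicator) (simp_all add: EV del: emeasure_completion)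
    finally show "?I / ennreal V \<le> C" using V by (intro divide_le_posI_ennreal) (auto simp: mult.commute)
  qed
  also have "\<dots> = ennreal N" using norm True by (simp add: Lp_norm_def)
  finally have "?I / ennreal V * ennreal V \<le> ennreal N * ennreal V" by (intro mult_right_mono) auto
  then have "?I \<le> ennreal (N * V)" using V N by (simp add: ennreal_divide_times ennreal_mult
      mult_divide_eq_ennreal)
  then show ?thesis using True V by (simp add: recip_def V_def)
next
  case False
  define P where "P = enn2real p"
  have pP: "p = ennreal P" using False unfolding P_def by (simp add: less_top)
  then have P: "P > 1" using p by (metis ennreal_less_iff ennreal_1 zero_le_one)
  have "enn_powr (\<integral>\<^sup>+ x. ennreal (\<bar>w x\<bar> powr P) \<partial>lebesgue) (1 / P) = ennreal N"
    using norm False unfolding Lp_norm_def P_def[symmetric] by (simp add: enn_powr_ennreal)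
  then have "(\<integral>\<^sup>+ x. ennreal (\<bar>w x\<bar> powr P) \<partial>lebesgue) = ennreal (N powr P)"
    using enn_powr_cancel[of P "\<integral>\<^sup>+ x. ennreal (\<bar>w x\<bar> powr P) \<partial>lebesgue"] P N
    by (simp add: enn_powr_ennreal)
  from ball_integral_le_Lp[OF P N r w this]
  show ?thesis using P pP by (simp add: recip_ennreal)
qed

section \<open>Pointwise estimates on the region\<close>

text \<open>\<open>r powr \<alpha> \<le> 1\<close> means \<open>r \<le> 1\<close> for
  \<open>\<alpha> > 0\<close> and \<open>r \<ge> 1\<close> for \<open>\<alpha> < 0\<close>. In each
  case \<open>\<beta> - b\<close> has the sign for which
  \<open>r powr (2 * (\<beta> - b)) \<le> 1\<close>, so \<open>\<beta>\<close> can be replaced by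
  the critical value \<open>b\<close> at the price of a power of the unit ball volume.\<close>

lemma Gamma_region_volume_powr_le:
  fixes y :: "'a::euclidean_space"
  assumes yr: "(y, r) \<in> Gamma_region \<alpha> x"
    and sgn: "\<alpha> > 0 \<and> \<beta> \<ge> b \<or> \<alpha> = 0 \<and> \<beta> = b \<or> \<alpha> < 0 \<and> \<beta> \<le> b"
  defines "V \<equiv> measure lebesgue (ball y r)"
  shows "1 / V powr (1 - 2 * \<beta> / real DIM('a))
    \<le> unit_ball_vol (real DIM('a)) powr (2 * (\<beta> - b) / real DIM('a)) * V powr (2 * b / real DIM('a) - 1)"
proof -
  let ?n = "real DIM('a)"
  have r: "r > 0" "r powr \<alpha> \<le> 1" using yr unfolding Gamma_region_def by auto
  have V: "V = unit_ball_vol ?n * r ^ DIM('a)" unfolding V_def using r by (simp add: content_ball)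
  have Vpos: "V > 0" unfolding V using r by simp
  have "r powr (2 * (\<beta> - b)) \<le> 1"
  proof -
    from sgn consider "\<alpha> > 0" "\<beta> \<ge> b" | "\<beta> = b" | "\<alpha> < 0" "\<beta> \<le> b" by auto
    then show ?thesis
    proof cases
      case 1
      have "r \<le> 1"
      proof (rule ccontr)
        assume "\<not> r \<le> 1"
        then have "r powr 0 < r powr \<alpha>" using 1 by (intro powr_less_mono) auto
        then show False using r by simp
      qed
      then show ?thesis using 1 r by (intro powr_le1) auto
    next
      case 2
      then show ?thesis using r by simp
    next
      case 3
      have "r \<ge> 1"
      proof (rule ccontr)
        assume "\<not> r \<ge> 1"
        then have "r powr 0 < r powr \<alpha>" using r 3 by (intro powr_less_mono') auto
        then show False using r by simp
      qed
      then have "r powr (2 * (\<beta> - b)) \<le> r powr 0" using 3 by (intro powr_mono) auto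
      then show ?thesis using r by simp
    qed
  qed
  moreover have "V powr (2 * (\<beta> - b) / ?n) = unit_ball_vol ?n powr (2 * (\<beta> - b) / ?n) * r powr (2 * (\<beta> - b))"
    unfolding V using r by (simp add: powr_mult powr_powr flip: powr_realpow)
  ultimately have *: "V powr (2 * (\<beta> - b) / ?n) \<le> unit_ball_vol ?n powr (2 * (\<beta> - b) / ?n)"
    by (metis mult_left_le powr_ge_zero)
  have "1 / V powr (1 - 2 * \<beta> / ?n) = V powr - (1 - 2 * \<beta> / ?n)"
    using powr_minus_divide[of V "1 - 2 * \<beta> / ?n"] by simp
  also have "- (1 - 2 * \<beta> / ?n) = 2 * (\<beta> - b) / ?n + (2 * b / ?n - 1)" by (simp add: field_simps)
  also have "V powr \<dots> = V powr (2 * (\<beta> - b) / ?n) * V powr (2 * b / ?n - 1)" by (simp add: powr_add)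
  also have "\<dots> \<le> unit_ball_vol ?n powr (2 * (\<beta> - b) / ?n) * V powr (2 * b / ?n - 1)"
    using * by (intro mult_right_mono) auto
  finally show ?thesis .
qed

text \<open>Hedberg's trick: \<open>P\<close> of the \<open>Q\<close> powers of the average are kept, the remaining \<open>Q - P\<close> are
  estimated by Hoelder.\<close>
lemma average_powr_le:
  fixes V A N P Q \<alpha> B :: real
  assumes V: "V > 0" and A: "A \<ge> 0" and PQ: "1 < P" "P \<le> Q" and B: "B \<ge> 0"
    and AN: "A \<le> N * V powr (- 1 / P)"
  shows "(B * V powr (\<alpha> / Q + 1 / P - 1 / Q) * A) powr Q
    \<le> B powr Q * N powr (Q - P) * (V powr \<alpha> * A powr P)"
proof (cases "A = 0")
  case False
  with A have A: "A > 0" by simp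
  with AN V have N: "N > 0" by (metis less_le_trans powr_gt_zero zero_less_mult_pos2 less_numeral_extra(3) order_less_le)
  have "A powr Q = A powr P * A powr (Q - P)" using A by (simp flip: powr_add)
  also have "\<dots> \<le> A powr P * (N * V powr (- 1 / P)) powr (Q - P)"
    using PQ A AN by (intro mult_left_mono powr_mono2) auto
  also have "(N * V powr (- 1 / P)) powr (Q - P) = N powr (Q - P) * V powr (1 - Q / P)"
  proof -
    have "- 1 / P * (Q - P) = 1 - Q / P" using PQ by (simp add: field_simps)
    then show ?thesis using N by (simp add: powr_mult powr_powr)
  qed
  finally have AQ: "A powr Q \<le> A powr P * (N powr (Q - P) * V powr (1 - Q / P))" .
  have "(B * V powr (\<alpha> / Q + 1 / P - 1 / Q) * A) powr Q
      = B powr Q * V powr (\<alpha> + Q / P - 1) * A powr Q"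
  proof -
    have "(\<alpha> / Q + 1 / P - 1 / Q) * Q = \<alpha> + Q / P - 1" using PQ by (simp add: field_simps)
    then show ?thesis using A B by (simp add: powr_mult powr_powr)
  qed
  also have "\<dots> \<le> B powr Q * V powr (\<alpha> + Q / P - 1) * (A powr P * (N powr (Q - P) * V powr (1 - Q / P)))"
    using AQ by (intro mult_left_mono) auto
  also have "\<dots> = B powr Q * N powr (Q - P) * ((V powr (\<alpha> + Q / P - 1) * V powr (1 - Q / P)) * A powr P)"
    by (simp add: mult_ac)
  \<comment> \<open>The surplus \<open>Q / P - 1\<close> from the prefactor cancels against
    Hoelder's estimate. What remains is the weight \<open>V powr \<alpha>\<close>, comparable to
    \<open>r powr (\<alpha> * n)\<close>.\<close>
  also have "V powr (\<alpha> + Q / P - 1) * V powr (1 - Q / P) = V powr \<alpha>"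
    by (simp flip: powr_add)
  finally show ?thesis .
qed (use PQ in simp)

section \<open>Boundedness for infinite and finite \<open>q\<close>\<close>

theorem theorem13:
  fixes p q :: ennreal and \<alpha> \<beta> :: real
  assumes "1 < p" and "p \<le> q"
    and "(\<alpha> > 0 \<and> \<beta> \<ge> \<alpha> * real DIM('a::euclidean_space) * recip q / 2
                 + real DIM('a) / 2 * (recip p - recip q))
       \<or> (\<alpha> = 0 \<and> \<beta> = real DIM('a) / 2 * (recip p - recip q))
       \<or> (\<alpha> < 0 \<and> \<beta> \<le> \<alpha> * real DIM('a) * recip q / 2
                 + real DIM('a) / 2 * (recip p - recip q))"
  shows "bounded_Lp_Lq p q (max_op \<alpha> \<beta> :: ('a \<Rightarrow> real) \<Rightarrow> 'a \<Rightarrow> ennreal)"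
proof -
  let ?n = "DIM('a)"
  define \<omega> where "\<omega> = unit_ball_vol (real ?n)"
  have \<omega>: "\<omega> > 0" unfolding \<omega>_def by simp
  \<comment> \<open>\<open>b\<close> is the critical value of \<open>\<beta>\<close>, and
    \<open>e\<close> is the power of the volume that multiplies the average when
    \<open>\<beta> = b\<close>.\<close>
  define b where "b = \<alpha> * real ?n * recip q / 2 + real ?n / 2 * (recip p - recip q)"
  define e where "e = \<alpha> * recip q + recip p - recip q"
  have be: "2 * b / real ?n = e" unfolding b_def e_def by (simp add: field_simps)
  have sgn: "\<alpha> > 0 \<and> \<beta> \<ge> b \<or> \<alpha> = 0 \<and> \<beta> = b \<or> \<alpha> < 0 \<and> \<beta> \<le> b"
    using assms(3) unfolding b_def by auto
  define B where "B = \<omega> powr (2 * (\<beta> - b) / real ?n)"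
  have B: "B > 0" unfolding B_def using \<omega> by simp
  define V where "V y r = measure lebesgue (ball y r)" for y :: 'a and r
  \<comment> \<open>The average as a real number. Hoelder's inequality shows that the integral is
    finite, so the conversion loses nothing.\<close>
  define A where "A w y r = enn2real (\<integral>\<^sup>+z\<in>ball y r. ennreal \<bar>w z\<bar> \<partial>lebesgue) / V y r" for w :: "'a \<Rightarrow> real" and y r
  have average: "A w y r \<ge> 0"
      "A w y r \<le> N * V y r powr - recip p"
      "(\<integral>\<^sup>+z\<in>ball y r. ennreal \<bar>w z\<bar> \<partial>lebesgue) = ennreal (A w y r * V y r)"
    if w: "w \<in> borel_measurable lebesgue" and N: "N \<ge> 0" "Lp_norm p (\<lambda>x. ennreal \<bar>w x\<bar>) = ennreal N"
      and r: "r > 0" for w y r N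
  proof -
    let ?I = "\<integral>\<^sup>+z\<in>ball y r. ennreal \<bar>w z\<bar> \<partial>lebesgue"
    have V: "V y r > 0" unfolding V_def using measure_lebesgue_ball_pos[OF r] .
    show "A w y r \<ge> 0" unfolding A_def using V by simp
    have le: "?I \<le> ennreal (N * V y r powr (1 - recip p))"
      unfolding V_def by (rule ball_integral_le_Lp_norm[OF assms(1) N(1) r w N(2)])
    then have "?I < \<infinity>" by (rule le_less_trans) simp
    then show "?I = ennreal (A w y r * V y r)" unfolding A_def using V by simp
    have "enn2real ?I \<le> N * V y r powr (1 - recip p)"
      using le N(1) by (intro enn2real_leI) auto
    then have "A w y r \<le> N * V y r powr (1 - recip p) / V y r"
      unfolding A_def using V by (intro divide_right_mono) auto
    then show "A w y r \<le> N * V y r powr - recip p"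
      using V by (simp add: powr_diff powr_minus field_simps)
  qed
  have max_op_le: "max_op \<alpha> \<beta> w x \<le> M"
    if w: "w \<in> borel_measurable lebesgue" and N: "N \<ge> 0" "Lp_norm p (\<lambda>x. ennreal \<bar>w x\<bar>) = ennreal N"
      and M: "\<And>y r. \<lbrakk>(y, r) \<in> Gamma_region \<alpha> x; r > 0; V y r > 0\<rbrakk> \<Longrightarrow> ennreal (B * V y r powr e * A w y r) \<le> M"
    for w x N M
    unfolding max_op_def
  proof (rule SUP_least)
    fix yr assume "yr \<in> Gamma_region \<alpha> x"
    then obtain y r where [simp]: "yr = (y, r)" and yr: "(y, r) \<in> Gamma_region \<alpha> x" by (cases yr) auto
    have r: "r > 0" using yr unfolding Gamma_region_def by auto
    have V: "V y r > 0" unfolding V_def using measure_lebesgue_ball_pos[OF r] .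
    note A = average[OF w N r, of y]
    have "ennreal (1 / V y r powr (1 - 2 * \<beta> / real ?n)) * ennreal (A w y r * V y r)
        \<le> ennreal (B * V y r powr (e - 1)) * ennreal (A w y r * V y r)"
      using Gamma_region_volume_powr_le[OF yr sgn] be
      unfolding V_def B_def \<omega>_def by (intro mult_right_mono ennreal_leI) auto
    also have "\<dots> = ennreal (B * V y r powr e * A w y r)"
      using B V A(1) by (simp add: ennreal_mult[symmetric] powr_diff)
    also have "\<dots> \<le> M" using M yr r V by blast
    finally show "ennreal (1 / measure lebesgue (ball (fst yr) (snd yr)) powr (1 - 2 * \<beta> / real ?n))
        * (\<integral>\<^sup>+ z \<in> ball (fst yr) (snd yr). ennreal \<bar>w z\<bar> \<partial>lebesgue) \<le> M"
      using A(3) unfolding V_def by simp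
  qed
  have "\<exists>C. \<forall>w N. w \<in> borel_measurable lebesgue \<and> N \<ge> 0 \<and> Lp_norm p (\<lambda>x. ennreal \<bar>w x\<bar>) = ennreal N
      \<longrightarrow> Lp_norm q (max_op \<alpha> \<beta> w :: 'a \<Rightarrow> ennreal) \<le> ennreal C * ennreal N"
  proof (cases "q = \<infinity>")
    \<comment> \<open>For \<open>q = \<infinity>\<close> the exponent \<open>e\<close> is
      \<open>recip p\<close>, which exactly balances Hoelder's bound on the average; no covering
      argument is used.\<close>
    case True
    then have e: "e = recip p" unfolding e_def by (simp add: recip_def)
    show ?thesis
    proof (intro exI[of _ B] allI impI)
      fix w :: "'a \<Rightarrow> real" and N :: real
      assume "w \<in> borel_measurable lebesgue \<and> N \<ge> 0 \<and> Lp_norm p (\<lambda>x. ennreal \<bar>w x\<bar>) = ennreal N"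
      then have w: "w \<in> borel_measurable lebesgue" and N: "N \<ge> 0" "Lp_norm p (\<lambda>x. ennreal \<bar>w x\<bar>) = ennreal N"
        by auto
      have "max_op \<alpha> \<beta> w x \<le> ennreal (B * N)" for x
      proof (rule max_op_le[OF w N])
        fix y r assume "r > 0" and V: "V y r > 0"
        have "B * V y r powr e * A w y r \<le> B * V y r powr e * (N * V y r powr - recip p)"
          using average[OF w N \<open>r > 0\<close>, of y] B by (intro mult_left_mono) auto
        also have "\<dots> = B * N" using V e by (simp add: powr_minus)
        finally show "ennreal (B * V y r powr e * A w y r) \<le> ennreal (B * N)" by (rule ennreal_leI)
      qed
      then show "Lp_norm q (max_op \<alpha> \<beta> w :: 'a \<Rightarrow> ennreal) \<le> ennreal B * ennreal N"
        unfolding Lp_norm_def using True B N by (simp add: ennreal_mult[symmetric]) (intro Inf_lower, simp)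
    qed
  next
    case False
    define P where "P = enn2real p"
    define Q where "Q = enn2real q"
    have "p \<noteq> \<infinity>" using False assms(2) by (auto simp: top_unique)
    then have pP: "p = ennreal P" and qQ: "q = ennreal Q"
      using False unfolding P_def Q_def by (auto simp: less_top)
    have "0 \<le> P" "0 \<le> Q" unfolding P_def Q_def by auto
    then have PQ: "1 < P" "P \<le> Q" using assms(1,2) pP qQ
      by (auto simp: ennreal_less_iff simp flip: ennreal_1)
    have rec: "recip p = 1 / P" "recip q = 1 / Q" unfolding pP qQ using PQ by (auto simp: recip_ennreal)
    have e: "e = \<alpha> / Q + 1 / P - 1 / Q" unfolding e_def rec by simp
    obtain C1 where C1: "C1 > 0" and strong: "\<And>w::'a \<Rightarrow> real. w \<in> borel_measurable lebesgue \<Longrightarrow>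
       \<exists>H \<in> borel_measurable lebesgue.
       (\<integral>\<^sup>+x. H x \<partial>lebesgue) \<le> ennreal C1 * (\<integral>\<^sup>+x. ennreal (\<bar>w x\<bar> powr P) \<partial>lebesgue) \<and>
       (\<forall>x y r A. (y, r) \<in> Gamma_region \<alpha> x \<and> A \<ge> 0 \<and>
          (\<integral>\<^sup>+z\<in>ball y r. ennreal \<bar>w z\<bar> \<partial>lebesgue) = ennreal (A * measure lebesgue (ball y r))
          \<longrightarrow> ennreal (r powr (\<alpha> * real ?n) * A powr P) \<le> H x)"
      using strong_majorant[OF PQ(1), where 'a = 'a and \<alpha> = \<alpha>] by blast
    \<comment> \<open>\<open>B powr Q\<close> comes from the prefactor, and
      \<open>\<omega> powr \<alpha>\<close> from writing \<open>V powr \<alpha>\<close> through the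
      radius.\<close>
    define D where "D = B powr Q * \<omega> powr \<alpha>"
    have D: "D > 0" unfolding D_def using B \<omega> by simp
    show ?thesis
    proof (intro exI[of _ "(D * C1) powr (1 / Q)"] allI impI)
      fix w :: "'a \<Rightarrow> real" and N :: real
      assume "w \<in> borel_measurable lebesgue \<and> N \<ge> 0 \<and> Lp_norm p (\<lambda>x. ennreal \<bar>w x\<bar>) = ennreal N"
      then have w: "w \<in> borel_measurable lebesgue" and N: "N \<ge> 0" "Lp_norm p (\<lambda>x. ennreal \<bar>w x\<bar>) = ennreal N"
        by auto
      have "enn_powr (\<integral>\<^sup>+ x. ennreal (\<bar>w x\<bar> powr P) \<partial>lebesgue) (1 / P) = ennreal N"
        using N(2) \<open>p \<noteq> \<infinity>\<close> unfolding Lp_norm_def P_def[symmetric] by (simp add: enn_powr_ennreal)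
      then have intw: "(\<integral>\<^sup>+ x. ennreal (\<bar>w x\<bar> powr P) \<partial>lebesgue) = ennreal (N powr P)"
        using enn_powr_cancel[of P "\<integral>\<^sup>+ x. ennreal (\<bar>w x\<bar> powr P) \<partial>lebesgue"] PQ N
        by (simp add: enn_powr_ennreal)
      from strong[OF w] obtain H where mH: "H \<in> borel_measurable lebesgue"
        and IH: "(\<integral>\<^sup>+x. H x \<partial>lebesgue) \<le> ennreal C1 * ennreal (N powr P)"
        and H: "\<And>x y r A. \<lbrakk>(y, r) \<in> Gamma_region \<alpha> x; A \<ge> 0;
          (\<integral>\<^sup>+z\<in>ball y r. ennreal \<bar>w z\<bar> \<partial>lebesgue) = ennreal (A * measure lebesgue (ball y r))\<rbrakk>
          \<Longrightarrow> ennreal (r powr (\<alpha> * real ?n) * A powr P) \<le> H x"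
        unfolding intw by blast
      \<comment> \<open>The factor \<open>N powr (Q - P)\<close> comes from the powers estimated by
        Hoelder. With the \<open>N powr P\<close> from the integral of \<open>H\<close> it
        recombines to \<open>N powr Q\<close>.\<close>
      define L where "L = D * N powr (Q - P)"
      have L: "L \<ge> 0" unfolding L_def using D by simp
      have bound: "enn_powr (max_op \<alpha> \<beta> w x) Q \<le> ennreal L * H x" for x
      proof -
        \<comment> \<open>Each ball is compared with the \<open>Q\<close>-th root of the majorant.
          The supremum is taken before the \<open>Q\<close>-th power is restored, and infinite
          values of \<open>H x\<close> need no separate treatment.\<close>
        have "max_op \<alpha> \<beta> w x \<le> enn_powr (ennreal L * H x) (1 / Q)"
        proof (rule max_op_le[OF w N])
          fix y r assume yr: "(y, r) \<in> Gamma_region \<alpha> x" and r: "r > 0" and V: "V y r > 0"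
          note A = average[OF w N r, of y]
          have "(B * V y r powr e * A w y r) powr Q
              \<le> B powr Q * N powr (Q - P) * (V y r powr \<alpha> * A w y r powr P)"
            unfolding e using A V B PQ rec by (intro average_powr_le) auto
          also have "V y r powr \<alpha> = \<omega> powr \<alpha> * r powr (\<alpha> * real ?n)"
          proof -
            have "V y r = \<omega> * r powr real ?n"
              unfolding V_def \<omega>_def using r by (simp add: content_ball powr_realpow)
            then show ?thesis using r \<omega> by (simp add: powr_mult powr_powr mult.commute)
          qed
          finally have "ennreal ((B * V y r powr e * A w y r) powr Q)
              \<le> ennreal (L * (r powr (\<alpha> * real ?n) * A w y r powr P))"
            unfolding L_def D_def by (intro ennreal_leI) (simp add: mult_ac)
          also have "\<dots> = ennreal L * ennreal (r powr (\<alpha> * real ?n) * A w y r powr P)"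
            using L by (simp add: ennreal_mult)
          also have "\<dots> \<le> ennreal L * H x"
            using H[OF yr A(1)] A(3) unfolding V_def by (intro mult_left_mono) auto
          finally have "enn_powr (ennreal ((B * V y r powr e * A w y r) powr Q)) (1 / Q)
              \<le> enn_powr (ennreal L * H x) (1 / Q)"
            using PQ by (intro enn_powr_mono) auto
          then show "ennreal (B * V y r powr e * A w y r) \<le> enn_powr (ennreal L * H x) (1 / Q)"
            using A(1) B PQ by (simp add: enn_powr_ennreal powr_powr)
        qed
        then have "enn_powr (max_op \<alpha> \<beta> w x) Q \<le> enn_powr (enn_powr (ennreal L * H x) (1 / Q)) Q"
          using PQ by (intro enn_powr_mono) auto
        then show ?thesis using PQ by (simp add: enn_powr_cancel)
      qed
      have "(\<integral>\<^sup>+x. enn_powr (max_op \<alpha> \<beta> w x) Q \<partial>lebesgue) \<le> (\<integral>\<^sup>+x. ennreal L * H x \<partial>lebesgue)"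
        by (rule nn_integral_mono) (rule bound)
      also have "\<dots> = ennreal L * (\<integral>\<^sup>+x. H x \<partial>lebesgue)" by (intro nn_integral_cmult mH)
      also have "\<dots> \<le> ennreal L * (ennreal C1 * ennreal (N powr P))"
        using IH by (intro mult_left_mono) auto
      also have "\<dots> = ennreal (D * C1 * N powr Q)"
      proof -
        have "N powr (Q - P) * N powr P = N powr Q" by (simp flip: powr_add)
        then show ?thesis unfolding L_def using D C1
          by (simp add: ennreal_mult[symmetric] mult_ac)
      qed
      finally have "enn_powr (\<integral>\<^sup>+x. enn_powr (max_op \<alpha> \<beta> w x) Q \<partial>lebesgue) (1 / Q)
          \<le> enn_powr (ennreal (D * C1 * N powr Q)) (1 / Q)"
        using PQ by (intro enn_powr_mono) auto
      also have "\<dots> = ennreal ((D * C1) powr (1 / Q)) * ennreal N"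
      proof -
        have "(D * C1 * N powr Q) powr (1 / Q) = (D * C1) powr (1 / Q) * N"
          using D C1 N PQ by (simp add: powr_mult powr_powr)
        then show ?thesis
          using D C1 N by (subst enn_powr_ennreal) (auto simp: ennreal_mult)
      qed
      finally show "Lp_norm q (max_op \<alpha> \<beta> w :: 'a \<Rightarrow> ennreal) \<le> ennreal ((D * C1) powr (1 / Q)) * ennreal N"
        unfolding Lp_norm_def Q_def[symmetric] using False by simp
    qed
  qed
  then obtain C where C: "\<And>w N. \<lbrakk>w \<in> borel_measurable lebesgue; N \<ge> 0; Lp_norm p (\<lambda>x. ennreal \<bar>w x\<bar>) = ennreal N\<rbrakk>
      \<Longrightarrow> Lp_norm q (max_op \<alpha> \<beta> w :: 'a \<Rightarrow> ennreal) \<le> ennreal C * ennreal N"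
    by blast
  show ?thesis unfolding bounded_Lp_Lq_def
  proof (intro exI[of _ C] allI impI)
    fix w :: "'a \<Rightarrow> real"
    assume w: "w \<in> borel_measurable lebesgue \<and> Lp_norm p (\<lambda>x. ennreal \<bar>w x\<bar>) < \<infinity>"
    define N where "N = enn2real (Lp_norm p (\<lambda>x. ennreal \<bar>w x\<bar>))"
    have "Lp_norm p (\<lambda>x. ennreal \<bar>w x\<bar>) = ennreal N" "N \<ge> 0" using w unfolding N_def by auto
    with w C borel_measurable_max_op
    show "max_op \<alpha> \<beta> w \<in> borel_measurable lebesgue \<and>
        Lp_norm q (max_op \<alpha> \<beta> w) \<le> ennreal C * Lp_norm p (\<lambda>x. ennreal \<bar>w x\<bar>)"
      by auto
  qed
qed

end
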